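(* Let $q$ be a prime power, let $n,t,s$ be positive integers with $\gcd(s,n)=1$, and let $\sigma\colon x\mapsto x^{q^s}$ on $\mathbb{F}_{q^{nt}}$ (whose restriction generates $\mathrm{Gal}(\mathbb{F}_{q^n}\colon\mathbb{F}_q)$). Let $a_0,\dots,a_{t-1}\in\mathbb{F}_{q^{nt}}$, \[ G(x)=a_0x+a_1x^{q^n}+\cdots+a_{t-1}x^{q^{n(t-1)}},\qquad F=G\circ\sigma, \] i.e. $F(x)=a_0x^{\sigma}+a_1x^{\sigma q^n}+\cdots+a_{t-1}x^{\sigma q^{n(t-1)}}$, and let \[ \mathcal{L}_F=\{\langle(x,F(x))\rangle_{\mathbb{F}_{q^{nt}}}\colon x\in\mathbb{F}_{q^{nt}}^*\}\subseteq\mathrm{PG}(1,q^{nt}). \] Let $P$ be a point of $\mathcal{L}_F$. Then: - $1\le w_{\mathcal{L}_F}(P)\le t-\dim_{\mathbb{F}_{q^n}}\ker G$ if $P\ne\langle(1,0)\rangle_{\mathbb{F}_{q^{nt}}}$; - $w_{\mathcal{L}_F}(\langle(1,0)\rangle_{\mathbb{F}_{q^{nt}}})=\dim_{\mathbb{F}_q}\ker G=n\cdot\dim_{\mathbb{F}_{q^n}}\ker G$.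
   Context: Notation: $x^{\sigma q^{ni}}:=x^{q^{s+ni}}$. For the $\mathbb{F}_q$-subspace $U=\{(x,F(x))\colon x\in\mathbb{F}_{q^{nt}}\}$ of $\mathbb{F}_{q^{nt}}^2$, the weight of a point $P=\langle\mathbf{u}\rangle_{\mathbb{F}_{q^{nt}}}$ of $\mathrm{PG}(1,q^{nt})$ is $w_{\mathcal{L}_F}(P)=\dim_{\mathbb{F}_q}(U\cap\langle\mathbf{u}\rangle_{\mathbb{F}_{q^{nt}}})$. $\ker G$ is the set of roots of $G$ in $\mathbb{F}_{q^{nt}}$, an $\mathbb{F}_{q^n}$-subspace. *)

theory Defs
  imports
    "HOL-Analysis.Product_Vector"
    "HOL-Library.Cardinality"
    "HOL-Number_Theory.Prime_Powers"
    "Subresultants.More_Homomorphisms"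
begin

text \<open>
  A field extension \<open>'k \<subseteq> 'm\<close> is a field homomorphism \<open>\<iota> :: 'k \<Rightarrow> 'm\<close>. It turns \<open>'m\<close> and \<open>'m \<times> 'm\<close>
  into vector spaces over \<open>'k\<close>, so that \<^term>\<open>vector_space.dim (ext_scale \<iota>)\<close> is the dimension over
  \<open>'k\<close> of a subspace of \<open>'m\<close>.
\<close>

definition ext_scale :: "('k::field \<Rightarrow> 'm::field) \<Rightarrow> 'k \<Rightarrow> 'm \<Rightarrow> 'm" where
  "ext_scale \<iota> c x = \<iota> c * x"

definition ext_scale2 :: "('k::field \<Rightarrow> 'm::field) \<Rightarrow> 'k \<Rightarrow> 'm \<times> 'm \<Rightarrow> 'm \<times> 'm" where
  "ext_scale2 \<iota> = module_prod.scale (ext_scale \<iota>) (ext_scale \<iota>)"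

definition lin_poly :: "nat \<Rightarrow> nat \<Rightarrow> nat \<Rightarrow> (nat \<Rightarrow> 'm::field) \<Rightarrow> 'm \<Rightarrow> 'm" where
  "lin_poly q n t a x = (\<Sum>i<t. a i * x ^ (q ^ (n * i)))"

definition frob :: "nat \<Rightarrow> nat \<Rightarrow> 'm::field \<Rightarrow> 'm" where
  "frob q s x = x ^ (q ^ s)"

definition roots :: "('m::field \<Rightarrow> 'm) \<Rightarrow> 'm set" where
  "roots f = {x. f x = 0}"

definition graph_of :: "('m::field \<Rightarrow> 'm) \<Rightarrow> ('m \<times> 'm) set" where
  "graph_of f = {(x, f x) | x. True}"

text \<open>
  Points of the projective line over \<open>'m\<close> are the one-dimensional \<open>'m\<close>-subspaces of \<open>'m \<times> 'm\<close>,
  i.e. the sets \<open>pg_point u\<close> with \<open>u \<noteq> 0\<close>.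
\<close>

definition pg_point :: "'m::field \<times> 'm \<Rightarrow> ('m \<times> 'm) set" where
  "pg_point u = module.span (ext_scale2 id) {u}"

definition linear_set :: "('m::field \<Rightarrow> 'm) \<Rightarrow> ('m \<times> 'm) set set" where
  "linear_set f = {pg_point (x, f x) | x. x \<noteq> 0}"

definition weight :: "('k::field \<Rightarrow> 'm::field) \<Rightarrow> ('m \<Rightarrow> 'm) \<Rightarrow> ('m \<times> 'm) set \<Rightarrow> nat" where
  "weight \<iota> f P = vector_space.dim (ext_scale2 \<iota>) (graph_of f \<inter> P)"

text \<open>The scalings are those of vector spaces, so \<open>span\<close> and \<open>dim\<close> have their usual meaning.\<close>

lemma vector_space_ext_scale:
  assumes "field_hom \<iota>"
  shows "vector_space (ext_scale \<iota>)"
proof -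
  interpret field_hom \<iota> by fact
  show ?thesis
    by unfold_locales (simp_all add: ext_scale_def hom_add hom_mult algebra_simps)
qed

lemma vector_space_ext_scale2:
  assumes "field_hom \<iota>"
  shows "vector_space (ext_scale2 \<iota>)"
proof -
  interpret v: vector_space "ext_scale \<iota>" by (rule vector_space_ext_scale[OF assms])
  interpret p: vector_space_prod "ext_scale \<iota>" "ext_scale \<iota>" by unfold_locales
  show ?thesis unfolding ext_scale2_def by (rule p.p.vector_space_axioms)
qed

lemma field_hom_id: "field_hom (id :: 'm::field \<Rightarrow> 'm)"
  by unfold_locales simp_all

lemma pg_point_eq: "pg_point (x, y) = {(c * x, c * y) | c. True}"
proof -
  interpret v: vector_space "ext_scale (id :: 'a \<Rightarrow> 'a)"
    by (rule vector_space_ext_scale[OF field_hom_id])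
  interpret p: vector_space_prod "ext_scale (id :: 'a \<Rightarrow> 'a)" "ext_scale (id :: 'a \<Rightarrow> 'a)"
    by unfold_locales
  show ?thesis
    unfolding pg_point_def ext_scale2_def p.p.span_singleton
    by (auto simp: p.scale_def ext_scale_def)
qed

end

theory Submission
  imports Defs
begin

text \<open>
  Write a point other than \<open>\<langle>(1, 0)\<rangle>\<close> as \<open>\<langle>(1, m)\<rangle>\<close> with \<open>m \<noteq> 0\<close>. Its weight is the dimension over
  \<open>\<F>\<^sub>q\<close> of the space of fixed points of \<open>\<phi> = m\<^sup>-\<^sup>1 F\<close>. As \<open>\<phi>\<close> is \<open>\<sigma>\<close>-semilinear and the fixed field of
  \<open>\<sigma>\<close> in \<open>\<F>\<^bsub>q^n\<^esub>\<close> is \<open>\<F>\<^sub>q\<close>, fixed points of \<open>\<phi>\<close> that are independent over \<open>\<F>\<^sub>q\<close> are independent over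
  \<open>\<F>\<^bsub>q^n\<^esub>\<close>. They lie in the image of \<open>m\<^sup>-\<^sup>1 G\<close>, whose dimension is \<open>t - dim (ker G)\<close>.
\<close>

subsection \<open>Finite fields\<close>

text \<open>Multiplication by \<open>x \<noteq> 0\<close> permutes the nonzero elements; comparing
  their products and cancelling gives \<open>x ^ (CARD('a) - 1) = 1\<close>.\<close>

lemma finite_field_power_card:
  fixes x :: "'a::{field,finite}"
  shows "x ^ CARD('a) = x"
proof (cases "x = 0")
  case False
  let ?U = "UNIV - {0} :: 'a set"
  have "bij_betw ((*) x) ?U ?U"
    by (rule bij_betw_byWitness[where f' = "\<lambda>y. y / x"]) (use False in auto)
  then have "\<Prod>?U = (\<Prod>y\<in>?U. x * y)"
    by (rule prod.reindex_bij_betw[symmetric])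
  also have "\<dots> = x ^ card ?U * \<Prod>?U"
    by (simp add: prod.distrib)
  finally have "x ^ card ?U = 1"
    by simp
  moreover have "CARD('a) = Suc (card ?U)"
    by (simp add: card_Diff_singleton)
  ultimately show ?thesis
    by (simp only: power_Suc mult_1_right)
qed (simp add: zero_power)

lemma power_power_eq_self:
  fixes x :: "'a::monoid_mult"
  assumes "x ^ q = x"
  shows "x ^ q ^ k = x"
  by (induction k) (simp_all add: assms power_mult)

text \<open>By Bezout, \<open>u\<close> applications of the \<open>q ^ s\<close> power amount to
  \<open>v\<close> applications of the \<open>q ^ n\<close> power followed by a single
  \<open>q\<close>-th power.\<close>

lemma frob_fixed_coprime:
  fixes x :: "'a::monoid_mult"
  assumes "s > 0" "gcd s n = 1" "x ^ q ^ s = x" "x ^ q ^ n = x"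
  shows "x ^ q = x"
proof -
  obtain u v where uv: "s * u = n * v + 1"
    using bezout_nat[of s n] assms(1,2) by auto
  have "x = x ^ q ^ (s * u)"
    using power_power_eq_self[OF assms(3), of u] by (simp add: power_mult)
  also have "\<dots> = (x ^ q ^ (n * v)) ^ q"
    by (simp add: uv power_mult[symmetric] mult.commute)
  also have "x ^ q ^ (n * v) = x"
    using power_power_eq_self[OF assms(4), of v] by (simp add: power_mult)
  finally show ?thesis
    by simp
qed

text \<open>With \<open>q = CARD('k)\<close>, the polynomial \<open>X^q - X\<close> has at most
  \<open>q\<close> roots, and the \<open>q\<close> elements of \<open>range \<iota>\<close> already
  are roots.\<close>

lemma fixed_by_frob_in_range:
  fixes \<iota> :: "'k::{field,finite} \<Rightarrow> 'l::field"
  assumes "field_hom \<iota>" and c: "c ^ CARD('k) = c"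
  shows "c \<in> range \<iota>"
proof -
  interpret field_hom \<iota> by fact
  let ?q = "CARD('k)"
  let ?p = "monom 1 ?q - monom 1 1 :: 'l poly"
  let ?R = "{x. poly ?p x = 0}"
  \<comment> \<open>\<open>q > 1\<close> keeps the two monomials distinct, so \<open>X^q - X\<close>
    is not the zero polynomial.\<close>
  have "card {0, 1 :: 'k} \<le> ?q"
    by (rule card_mono) auto
  then have q: "?q > 1"
    by simp
  then have "coeff ?p ?q = 1"
    by simp
  then have nz: "?p \<noteq> 0"
    by (metis coeff_0 zero_neq_one)
  have "card ?R \<le> degree ?p"
    by (rule card_poly_roots_bound[OF nz])
  also have "\<dots> \<le> ?q"
    by (rule degree_diff_le) (use q in \<open>auto simp: degree_monom_eq\<close>)
  also have "?q = card (range \<iota>)"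
    by (simp add: card_image inj_f)
  finally have "card ?R \<le> card (range \<iota>)" .
  moreover have "range \<iota> \<subseteq> ?R"
    by (auto simp: poly_monom finite_field_power_card simp flip: hom_power)
  ultimately have "range \<iota> = ?R"
    by (intro card_seteq poly_roots_finite nz)
  then show ?thesis
    using c by (simp add: poly_monom)
qed

lemma frob_add:
  fixes x y :: "'m::{field,finite}"
  assumes "primepow q" "CARD('m) = q ^ N"
  shows "(x + y) ^ q ^ j = x ^ q ^ j + y ^ q ^ j"
proof -
  obtain p k where p: "prime p" "q = p ^ k"
    using assms(1) by (auto simp: primepow_def)
  have CHAR: "prime CHAR('m)"
    by (rule prime_CHAR_semidom) (simp add: finite_imp_CHAR_pos)
  \<comment> \<open>Translation by 1 permutes the field; comparing the sums of all elements shows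
    that \<open>CARD('m)\<close> vanishes in the field, which forces the characteristic to be
    \<open>p\<close>.\<close>
  have "bij (\<lambda>z::'m. z + 1)"
    by (rule bij_betw_byWitness[where f' = "\<lambda>z. z - 1"]) auto
  then have "\<Sum>UNIV = (\<Sum>z::'m\<in>UNIV. z + 1)"
    by (rule sum.reindex_bij_betw[symmetric])
  then have "of_nat CARD('m) = (0 :: 'm)"
    by (simp add: sum.distrib)
  then have "CHAR('m) dvd CARD('m)"
    by (simp add: of_nat_eq_0_iff_char_dvd)
  then have "CHAR('m) dvd p"
    using CHAR by (simp add: assms(2) p(2) prime_dvd_power flip: power_mult)
  then have "CHAR('m) = p"
    using CHAR p(1) primes_dvd_imp_eq by blast
  then show ?thesis
    using freshmans_dream'[OF CHAR, of "q ^ j" "k * j" x y] by (simp add: p(2) power_mult)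
qed

subsection \<open>Vector spaces over finite fields\<close>

context vector_space
begin

text \<open>Elements of \<open>span (insert b B)\<close> are uniquely \<open>k *s b + x\<close> with
  \<open>x \<in> span B\<close>, so each basis vector contributes one factor.\<close>

lemma card_span_independent:
  assumes "finite (UNIV :: 'a set)" "finite B" "independent B"
  shows "card (span B) = CARD('a) ^ card B"
  using assms(2,3)
proof (induction B)
  case (insert b B)
  then have b: "b \<notin> span B" "independent B"
    by (auto simp: independent_insert)
  let ?f = "\<lambda>(k, x). k *s b + x"
  have "inj_on ?f (UNIV \<times> span B)"
  proof (rule inj_onI, clarify)
    fix k x l y
    assume xy: "x \<in> span B" "y \<in> span B" and eq: "k *s b + x = l *s b + y"
    then have "(k - l) *s b = y - x"
      by (simp add: algebra_simps)
    then have "(k - l) *s b \<in> span B"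
      using xy by (simp add: span_diff)
    from span_scale[OF this, of "inverse (k - l)"] b(1) have "k = l"
      by (cases "k = l") auto
    then show "k = l \<and> x = y"
      using eq by simp
  qed
  moreover have "span (insert b B) = ?f ` (UNIV \<times> span B)"
  proof (rule equalityI; rule subsetI)
    fix x assume "x \<in> span (insert b B)"
    then obtain k where "x - k *s b \<in> span B"
      by (auto simp: span_breakdown_eq)
    then show "x \<in> ?f ` (UNIV \<times> span B)"
      by (intro image_eqI[where x = "(k, x - k *s b)"]) auto
  next
    fix x assume "x \<in> ?f ` (UNIV \<times> span B)"
    then obtain k y where "y \<in> span B" "x = k *s b + y"
      by auto
    then show "x \<in> span (insert b B)"
      unfolding span_breakdown_eq by (intro exI[of _ k]) simp
  qed
  ultimately show ?case
    using insert b(2) by (simp add: card_image card_cartesian_product)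
qed simp

text \<open>Allows dimensions, even over different fields, to be compared by counting.\<close>

lemma card_subspace:
  assumes "finite (UNIV :: 'a set)" "finite V" "subspace V"
  shows "card V = CARD('a) ^ dim V"
proof -
  obtain B where B: "B \<subseteq> V" "independent B" "V \<subseteq> span B" "card B = dim V"
    using basis_exists by blast
  then have "span B = V"
    using assms(3) span_minimal by blast
  then show ?thesis
    using card_span_independent[OF assms(1) _ B(2)] B(1,4) assms(2) finite_subset by auto
qed

end

lemma additive_zero:
  fixes f :: "'a::ab_group_add \<Rightarrow> 'b::ab_group_add"
  assumes "\<And>x y. f (x + y) = f x + f y"
  shows "f 0 = 0"
  using assms[of 0 0] by (simp only: add_0_right add_cancel_right_right)

text \<open>All nonempty fibres are translates of the kernel. Together with
  \<open>card_subspace\<close> this serves as rank-nullity.\<close>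

lemma card_kernel_times_card_range:
  fixes f :: "'a::{ab_group_add,finite} \<Rightarrow> 'b::ab_group_add"
  assumes add: "\<And>x y. f (x + y) = f x + f y"
  shows "card {x. f x = 0} * card (range f) = CARD('a)"
proof -
  have fibre: "card {x. f x = y} = card {x. f x = 0}" if y: "y \<in> range f" for y
  proof -
    obtain z where z: "f z = y"
      using y by auto
    have "{x. f x = y} = (+) z ` {x. f x = 0}"
    proof (rule equalityI; rule subsetI)
      fix x assume "x \<in> {x. f x = y}"
      then have "f (x - z) = 0"
        using add[of "x - z" z] z by simp
      then show "x \<in> (+) z ` {x. f x = 0}"
        by (intro image_eqI[where x = "x - z"]) auto
    qed (auto simp: add z)
    then show ?thesis
      by (simp add: card_image)
  qed
  have "CARD('a) = (\<Sum>y\<in>range f. card {x. f x = y})"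
    using sum.image_gen[of UNIV "\<lambda>_. 1::nat" f] by simp
  also have "\<dots> = card (range f) * card {x. f x = 0}"
    by (simp add: fibre)
  finally show ?thesis
    by simp
qed

text \<open>Suppose a fixed point is a combination of others over \<open>'l\<close>. Applying
  \<open>\<phi>\<close> only changes the coefficients by \<open>\<tau>\<close>; since they are
  unique, they are \<open>\<tau>\<close>-fixed, hence come from \<open>'k\<close>, contradicting
  independence over \<open>'k\<close>.\<close>

lemma semilinear_fixed_points_independent:
  fixes \<phi> :: "'m::field \<Rightarrow> 'm" and \<kappa> :: "'k::field \<Rightarrow> 'm" and \<iota> :: "'l::field \<Rightarrow> 'm"
  assumes hom: "field_hom \<iota>" "field_hom \<kappa>"
    and add: "\<And>x y. \<phi> (x + y) = \<phi> x + \<phi> y"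
    and semilinear: "\<And>c x. \<phi> (\<iota> c * x) = \<iota> (\<tau> c) * \<phi> x"
    and fixed: "\<And>c. \<tau> c = c \<Longrightarrow> \<iota> c \<in> range \<kappa>"
    and B: "finite B" "\<And>b. b \<in> B \<Longrightarrow> \<phi> b = b"
    and indep: "\<not> module.dependent (ext_scale \<kappa>) B"
  shows "\<not> module.dependent (ext_scale \<iota>) B"
proof -
  interpret L: vector_space "ext_scale \<iota>"
    by (rule vector_space_ext_scale[OF hom(1)])
  interpret K: vector_space "ext_scale \<kappa>"
    by (rule vector_space_ext_scale[OF hom(2)])
  interpret h: field_hom \<iota>
    by (rule hom)
  have "\<phi> 0 = 0"
    by (rule additive_zero) (rule add)
  then have sum: "\<phi> (sum f A) = (\<Sum>a\<in>A. \<phi> (f a))" for f :: "'m \<Rightarrow> 'm" and A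
    by (induction A rule: infinite_finite_induct) (simp_all add: add)
  show ?thesis
    using B indep
  proof (induction B)
    case (insert b B)
    then have IH: "L.independent B" and b: "b \<notin> K.span B"
      by (auto simp: K.independent_insert)
    have "b \<notin> L.span B"
    proof
      assume "b \<in> L.span B"
      then obtain u where u: "b = (\<Sum>v\<in>B. \<iota> (u v) * v)"
        by (auto simp: L.span_finite[OF insert(1)] ext_scale_def)
      have "b = \<phi> b"
        using insert.prems by simp
      also have "\<dots> = (\<Sum>v\<in>B. \<iota> (\<tau> (u v)) * v)"
        using insert.prems by (simp add: u sum semilinear)
      finally have "(\<Sum>v\<in>B. ext_scale \<iota> (\<tau> (u v) - u v) v) = 0"
        using u by (simp add: ext_scale_def h.hom_minus left_diff_distrib sum_subtractf)
      then have "\<tau> (u v) - u v = 0" if "v \<in> B" for v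
        using L.independentD[OF IH insert(1) subset_refl, of "\<lambda>v. \<tau> (u v) - u v"] that by blast
      then have "\<forall>v\<in>B. \<exists>w. \<iota> (u v) = \<kappa> w"
        using fixed by fastforce
      then obtain w where "\<And>v. v \<in> B \<Longrightarrow> \<iota> (u v) = \<kappa> (w v)"
        by metis
      then have "b = (\<Sum>v\<in>B. ext_scale \<kappa> (w v) v)"
        by (simp add: u ext_scale_def)
      then show False
        using b by (simp add: K.span_finite[OF insert(1)])
    qed
    then show ?case
      using IH by (rule L.independent_insertI)
  qed (rule L.independent_empty)
qed

subsection \<open>Weights of points\<close>

text \<open>Parametrising the point by its first coordinate turns weights into dimensions of
  eigenspaces.\<close>

lemma graph_Int_pg_point:
  "graph_of f \<inter> pg_point (1, m) = (\<lambda>x. (x, f x)) ` {x. f x = m * x}"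
  by (auto simp: graph_of_def pg_point_eq mult.commute)

lemma pg_point_normalize:
  fixes x y :: "'m::field"
  assumes "x \<noteq> 0"
  shows "pg_point (x, y) = pg_point (1, y / x)"
proof -
  have "\<exists>c'. (c * x, c * y) = (c' * 1, c' * (y / x))" for c
    using assms by (intro exI[of _ "c * x"]) simp
  moreover have "\<exists>c. (c' * 1, c' * (y / x)) = (c * x, c * y)" for c'
    using assms by (intro exI[of _ "c' / x"]) simp
  ultimately show ?thesis
    unfolding pg_point_eq by blast
qed

text \<open>Kernels are covered as well, by \<open>m = 0\<close>.\<close>

lemma subspace_eigenspace:
  fixes f :: "'m::field \<Rightarrow> 'm"
  assumes hom: "field_hom \<kappa>"
    and add: "\<And>x y. f (x + y) = f x + f y" and scale: "\<And>c x. f (\<kappa> c * x) = \<kappa> c * f x"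
  shows "module.subspace (ext_scale \<kappa>) {x. f x = m * x}"
proof -
  interpret V: vector_space "ext_scale \<kappa>"
    by (rule vector_space_ext_scale[OF hom])
  have "f 0 = 0"
    by (rule additive_zero) (rule add)
  then show ?thesis
    by (auto simp: V.subspace_def ext_scale_def add scale distrib_left mult.left_commute)
qed

text \<open>The map \<open>x \<mapsto> (x, f x)\<close> is linear and injective, so it preserves the
  cardinality of the eigenspace and hence its dimension.\<close>

lemma weight_eq_dim:
  fixes \<kappa> :: "'k::{field,finite} \<Rightarrow> 'm::{field,finite}"
  assumes hom: "field_hom \<kappa>"
    and add: "\<And>x y. f (x + y) = f x + f y" and scale: "\<And>c x. f (\<kappa> c * x) = \<kappa> c * f x"
  shows "weight \<kappa> f (pg_point (1, m)) = vector_space.dim (ext_scale \<kappa>) {x. f x = m * x}"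
proof -
  interpret V: vector_space "ext_scale \<kappa>"
    by (rule vector_space_ext_scale[OF hom])
  interpret W: vector_space "ext_scale2 \<kappa>"
    by (rule vector_space_ext_scale2[OF hom])
  interpret p: vector_space_prod "ext_scale \<kappa>" "ext_scale \<kappa>"
    by unfold_locales
  let ?T = "{x. f x = m * x}" and ?g = "\<lambda>x. (x, f x)"
  have T: "V.subspace ?T"
    using subspace_eigenspace[of \<kappa> f m] assms by blast
  interpret g: Vector_Spaces.linear "ext_scale \<kappa>" "ext_scale2 \<kappa>" ?g
    by unfold_locales (auto simp: add scale ext_scale2_def p.scale_def ext_scale_def)
  have "W.subspace (?g ` ?T)"
    by (rule g.subspace_image[OF T])
  then have "CARD('k) ^ W.dim (?g ` ?T) = card (?g ` ?T)"
    by (intro W.card_subspace[symmetric]) auto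
  also have "\<dots> = card ?T"
    by (intro card_image inj_onI) simp
  also have "\<dots> = CARD('k) ^ V.dim ?T"
    by (intro V.card_subspace T) auto
  \<comment> \<open>The elements \<open>0\<close> and \<open>1\<close> make the base exceed 1, so
    the exponents agree.\<close>
  finally have "W.dim (?g ` ?T) = V.dim ?T"
    using card_mono[of UNIV "{0, 1 :: 'k}"] by (simp add: power_inject_exp)
  then show ?thesis
    by (simp add: weight_def graph_Int_pg_point)
qed

theorem theorem7p1:
  fixes q n t s :: nat
    and \<iota>\<^sub>1 :: "'k::{field,finite} \<Rightarrow> 'l::{field,finite}"
    and \<iota>\<^sub>2 :: "'l \<Rightarrow> 'm::{field,finite}"
    and a :: "nat \<Rightarrow> 'm"
    and P :: "('m \<times> 'm) set"
  assumes "primepow q" and "n > 0" and "t > 0" and "s > 0" and "gcd s n = 1"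
    and "CARD('k) = q" and "CARD('l) = q ^ n" and "CARD('m) = q ^ (n * t)"
    and "field_hom \<iota>\<^sub>1" and "field_hom \<iota>\<^sub>2"
    and "P \<in> linear_set (lin_poly q n t a \<circ> frob q s)"
  shows "(P \<noteq> pg_point (1, 0) \<longrightarrow>
            1 \<le> weight (\<iota>\<^sub>2 \<circ> \<iota>\<^sub>1) (lin_poly q n t a \<circ> frob q s) P \<and>
            int (weight (\<iota>\<^sub>2 \<circ> \<iota>\<^sub>1) (lin_poly q n t a \<circ> frob q s) P)
              \<le> int t - int (vector_space.dim (ext_scale \<iota>\<^sub>2) (roots (lin_poly q n t a)))) \<and>
         weight (\<iota>\<^sub>2 \<circ> \<iota>\<^sub>1) (lin_poly q n t a \<circ> frob q s) (pg_point (1, 0))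
           = vector_space.dim (ext_scale (\<iota>\<^sub>2 \<circ> \<iota>\<^sub>1)) (roots (lin_poly q n t a)) \<and>
         vector_space.dim (ext_scale (\<iota>\<^sub>2 \<circ> \<iota>\<^sub>1)) (roots (lin_poly q n t a))
           = n * vector_space.dim (ext_scale \<iota>\<^sub>2) (roots (lin_poly q n t a))"
proof -

  \<comment> \<open>Linearity of \<open>G\<close> and semilinearity of \<open>F\<close>\<close>
  let ?\<kappa> = "\<iota>\<^sub>2 \<circ> \<iota>\<^sub>1" and ?G = "lin_poly q n t a" and ?dG = "vector_space.dim (ext_scale \<iota>\<^sub>2) (roots (lin_poly q n t a))"
  let ?F = "?G \<circ> frob q s"
  interpret h\<^sub>1: field_hom \<iota>\<^sub>1 by fact
  interpret h\<^sub>2: field_hom \<iota>\<^sub>2 by fact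
  have hom: "field_hom ?\<kappa>"
    by unfold_locales (simp_all add: h\<^sub>1.hom_add h\<^sub>1.hom_mult h\<^sub>2.hom_add h\<^sub>2.hom_mult)
  interpret L: vector_space "ext_scale \<iota>\<^sub>2"
    by (rule vector_space_ext_scale) fact
  interpret K: vector_space "ext_scale ?\<kappa>"
    by (rule vector_space_ext_scale[OF hom])
  have q: "q > 1"
    using primepow_gt_Suc_0[OF assms(1)] by simp
  note frob_add = frob_add[OF assms(1,8)]
  \<comment> \<open>Every exponent occurring in \<open>G\<close> fixes the scalars from
    \<open>'l\<close>, hence \<open>G\<close> is \<open>'l\<close>-linear; \<open>F\<close> twists
    them by \<sigma>, which is trivial on \<open>'k\<close>.\<close>
  have frob_L: "c ^ q ^ (n * i) = c" for c :: 'l and i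
    using power_power_eq_self[OF finite_field_power_card[of c], of i] by (simp add: assms(7) power_mult)
  have frob_K: "c ^ q ^ i = c" for c :: 'k and i
    using power_power_eq_self[OF finite_field_power_card[of c], of i] by (simp add: assms(6))
  have G_add: "?G (x + y) = ?G x + ?G y" for x y
    by (simp add: lin_poly_def frob_add distrib_left sum.distrib)
  have G_scale: "?G (\<iota>\<^sub>2 c * x) = \<iota>\<^sub>2 c * ?G x" for c x
    by (simp add: lin_poly_def power_mult_distrib frob_L sum_distrib_left mult.left_commute flip: h\<^sub>2.hom_power)
  have F_add: "?F (x + y) = ?F x + ?F y" for x y
    by (simp add: frob_def frob_add G_add)
  have F_semilinear: "?F (\<iota>\<^sub>2 c * x) = \<iota>\<^sub>2 (c ^ q ^ s) * ?F x" for c x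
    by (simp add: frob_def power_mult_distrib G_scale flip: h\<^sub>2.hom_power)
  have F_scale: "?F (?\<kappa> c * x) = ?\<kappa> c * ?F x" for c x
    using F_semilinear[of "\<iota>\<^sub>1 c" x] by (simp add: frob_K flip: h\<^sub>1.hom_power)
  have eigenspace: "K.subspace {x. ?F x = m * x}" for m
    using subspace_eigenspace[of ?\<kappa> ?F m, OF hom F_add F_scale] .
  note weight = weight_eq_dim[of ?\<kappa> ?F, OF hom F_add F_scale]

  \<comment> \<open>The kernel of \<open>G\<close> over both fields\<close>
  have G_zero_iff: "roots ?G = {x. ?G x = 0 * x}"
    by (simp add: roots_def)
  have roots_L: "L.subspace (roots ?G)"
    unfolding G_zero_iff using subspace_eigenspace[of \<iota>\<^sub>2 ?G 0, OF assms(10) G_add G_scale] .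
  have roots_K: "K.subspace (roots ?G)"
    unfolding G_zero_iff using subspace_eigenspace[of ?\<kappa> ?G 0, OF hom G_add] by (simp add: G_scale)
  have card_roots_K: "card (roots ?G) = q ^ K.dim (roots ?G)"
    using K.card_subspace[OF _ _ roots_K] by (simp add: assms(6))
  have card_roots_L: "card (roots ?G) = (q ^ n) ^ ?dG"
    using L.card_subspace[OF _ _ roots_L] by (simp add: assms(7))
  \<comment> \<open>The same cardinality is a power of \<open>q\<close> and of
    \<open>q ^ n\<close>.\<close>
  have dim_K: "K.dim (roots ?G) = n * ?dG"
    using card_roots_K card_roots_L q by (simp add: power_inject_exp flip: power_mult)

  \<comment> \<open>The weight of the point with \<open>m = 0\<close>\<close>
  have inj_frob: "inj (frob q s :: 'm \<Rightarrow> 'm)"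
  proof (rule injI)
    fix x y :: 'm
    assume "frob q s x = frob q s y"
    then have "(x - y) ^ q ^ s = 0"
      using frob_add[of "x - y" y s] by (simp add: frob_def)
    then show "x = y"
      by simp
  qed
  then have "bij (frob q s :: 'm \<Rightarrow> 'm)"
    by (simp add: bij_def finite_UNIV_inj_surj)
  \<comment> \<open>The kernel of \<open>F\<close> is the preimage of the kernel of \<open>G\<close>
    under the bijection \<sigma>, so both have the same size and the same dimension over
    \<open>'k\<close>.\<close>
  then have "card (roots ?G) = card (frob q s -` roots ?G)"
    by (metis bij_is_inj bij_is_surj card_vimage_inj top_greatest)
  also have "frob q s -` roots ?G = {x. ?F x = 0 * x}"
    by (auto simp: roots_def)
  finally have "card (roots ?G) = card {x. ?F x = 0 * x}" .
  also have "\<dots> = q ^ K.dim {x. ?F x = 0 * x}"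
    using K.card_subspace[OF _ _ eigenspace[of 0]] by (simp add: assms(6))
  finally have weight_0: "weight ?\<kappa> ?F (pg_point (1, 0)) = K.dim (roots ?G)"
    using q weight[of 0] by (simp add: card_roots_K power_inject_exp)

  \<comment> \<open>Bounds on the weights of the other points\<close>
  have "1 \<le> weight ?\<kappa> ?F P \<and> int (weight ?\<kappa> ?F P) \<le> int t - int ?dG" if P: "P \<noteq> pg_point (1, 0)"
  proof -
    obtain x\<^sub>0 where x\<^sub>0: "x\<^sub>0 \<noteq> 0" "P = pg_point (x\<^sub>0, ?F x\<^sub>0)"
      using assms(11) by (auto simp: linear_set_def)
    define m where "m = ?F x\<^sub>0 / x\<^sub>0"
    have P_eq: "P = pg_point (1, m)"
      unfolding m_def x\<^sub>0(2) by (rule pg_point_normalize[OF x\<^sub>0(1)])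
    then have m: "m \<noteq> 0"
      using P by auto
    define T where "T = {x. ?F x = m * x}"
    have T: "K.subspace T"
      unfolding T_def by (rule eigenspace)
    have weight_P: "weight ?\<kappa> ?F P = K.dim T"
      unfolding P_eq T_def by (rule weight)
    obtain B where B: "B \<subseteq> T" "K.independent B" "T \<subseteq> K.span B" "card B = K.dim T"
      using K.basis_exists by blast
    \<comment> \<open>The nonzero vector defining \<open>P\<close> itself gives the lower
      bound.\<close>
    have "x\<^sub>0 \<in> T"
      using x\<^sub>0(1) by (simp add: T_def m_def)
    then have "B \<noteq> {}"
      using B(3) x\<^sub>0(1) by auto
    then have ge: "1 \<le> K.dim T"
      using B(4) by (metis One_nat_def Suc_leI card_gt_0_iff finite_class.finite)

    \<comment> \<open>The scaling makes \<open>T\<close> the fixed space of \<open>H\<close> after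
      \<sigma>, while \<open>H\<close> keeps the kernel of \<open>G\<close> because
      \<open>m \<noteq> 0\<close>.\<close>
    define H where "H x = inverse m * ?G x" for x
    have H_add: "H (x + y) = H x + H y" and H_scale: "H (\<iota>\<^sub>2 c * x) = \<iota>\<^sub>2 c * H x" for x y c
      by (simp_all add: H_def G_add G_scale distrib_left mult.left_commute)
    interpret H: Vector_Spaces.linear "ext_scale \<iota>\<^sub>2" "ext_scale \<iota>\<^sub>2" H
      by unfold_locales (auto simp: ext_scale_def H_add H_scale)
    have "card {x. H x = 0} * card (range H) = CARD('m)"
      by (rule card_kernel_times_card_range) (fact H_add)
    moreover have "{x. H x = 0} = roots ?G"
      using m by (auto simp: H_def roots_def)
    moreover have "card (range H) = (q ^ n) ^ L.dim (range H)"
      using L.card_subspace[OF _ _ H.subspace_image[OF L.subspace_UNIV]] by (simp add: assms(7))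
    \<comment> \<open>Rank-nullity for \<open>H\<close> over \<open>'l\<close>, read off from
      cardinalities.\<close>
    ultimately have "(q ^ n) ^ (?dG + L.dim (range H)) = (q ^ n) ^ t"
      by (simp add: card_roots_L assms(8) power_add power_mult)
    moreover have "q ^ n > 1"
      using q assms(2) by (rule one_less_power)
    ultimately have rank: "?dG + L.dim (range H) = t"
      by (simp add: power_inject_exp)

    have fixed: "H (frob q s b) = b" if "b \<in> B" for b
      using that B(1) m by (auto simp: T_def H_def)
    have "L.independent B"
    proof (rule semilinear_fixed_points_independent[where \<phi> = "\<lambda>x. H (frob q s x)" and \<tau> = "\<lambda>c. c ^ q ^ s"])
      show "H (frob q s (x + y)) = H (frob q s x) + H (frob q s y)" for x y
        using F_add by (simp add: H_def distrib_left)
      show "H (frob q s (\<iota>\<^sub>2 c * x)) = \<iota>\<^sub>2 (c ^ q ^ s) * H (frob q s x)" for c x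
        using F_semilinear by (simp add: H_def mult.left_commute)
      \<comment> \<open>Scalars in \<open>'l\<close> are also fixed by the \<open>q ^ n\<close>
        power, so coprimality of \<open>s\<close> and \<open>n\<close> leaves only those coming from
        \<open>'k\<close>.\<close>
      show "\<iota>\<^sub>2 c \<in> range ?\<kappa>" if "c ^ q ^ s = c" for c
      proof -
        have "c ^ CARD('k) = c"
          using frob_fixed_coprime[OF assms(4,5) that] frob_L[of c 1] by (simp add: assms(6))
        then have "c \<in> range \<iota>\<^sub>1"
          by (rule fixed_by_frob_in_range[OF assms(9)])
        then show ?thesis
          by auto
      qed
    qed (use hom assms(10) fixed B(2) in auto)
    \<comment> \<open>Each \<open>b\<close> equals \<open>H (frob q s b)\<close>, so the rank of
      \<open>H\<close> over \<open>'l\<close> bounds \<open>card B\<close>, which is the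
      weight.\<close>
    moreover have "B \<subseteq> range H"
      using fixed by (metis rangeI subsetI)
    ultimately have "card B \<le> L.dim (range H)"
      by (metis L.basis_card_eq_dim L.independent_span_bound L.maximal_independent_subset
          finite_class.finite order_trans)
    then show ?thesis
      using ge rank B(4) by (simp add: weight_P)
  qed
  then show ?thesis
    using weight_0 dim_K by simp
qed

end
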